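(* Given $W=(w_{i,j})\in\mathbb{R}_+^{n\times k}$ and any $\ell\in\mathbb{R}_+^k$, the convex hull of $\mathcal{M}(W,\ell,0)$ is described by the bounds $\mathbf 0\le z\le\mathbf 1$ and, for $j\in[k]$, the mixing inequalities of the form $$y_j+\sum_{s\in[\tau]}(w_{j_s,j}-w_{j_{s+1},j})z_{j_s}\ge\max\{w_{i,j}:i\in[n]\},$$ where $\{j_1\to\cdots\to j_\tau\}$ is a $j$-mixing-sequence with $w_{j_1,j}=\max\{w_{i,j}:i\in[n]\}$ and $w_{j_{\tau+1},j}:=\ell_j$.
   Context: $n,k\ge1$ are integers and $[n]=\{1,\dots,n\}$. $\mathcal{M}(W,\ell,0)=\{(y,z)\in\mathbb{R}^k\times\{0,1\}^n:\ y_j+w_{i,j}z_i\ge w_{i,j}\ \forall i\in[n],j\in[k];\ y_j\ge\ell_j\ \forall j\in[k]\}$. For $j\in[k]$, a $j$-mixing-sequence is a sequence $\{j_1\to\cdots\to j_\tau\}$ of indices in $[n]$ with $w_{j_1,j}\ge w_{j_2,j}\ge\cdots\ge w_{j_\tau,j}\ge\ell_j$. "Is described by" means: equals the set of all $(y,z)\in\mathbb{R}^k\times\mathbb{R}^n$ satisfying all the listed inequalities.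
   Formalization: The formal theorem additionally assumes ℓ_j ≤ max_i w_{i,j} for every j; otherwise no j-mixing-sequence starting at the maximum exists, y_j is unbounded below in the described set, and the claim is false (e.g. n=k=1, w=0, ℓ=1). *)

theory Defs
  imports "HOL-Analysis.Analysis"
begin

text \<open>
  The index sets \<open>[n]\<close> and \<open>[k]\<close> are finite types \<open>'n\<close> and \<open>'k\<close>; they are nonempty, so
  \<open>n, k \<ge> 1\<close> holds automatically. The weight \<open>w\<^sub>i\<^sub>,\<^sub>j\<close> is \<open>W $ i $ j\<close>.
\<close>

definition mixing_set0 ::
  "real ^ 'k ^ 'n \<Rightarrow> real ^ 'k \<Rightarrow> ((real ^ 'k) \<times> (real ^ 'n)) set" where
  "mixing_set0 W l =
     {(y, z). (\<forall>i. z $ i \<in> {0, 1})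
        \<and> (\<forall>i j. y $ j + W $ i $ j * z $ i \<ge> W $ i $ j)
        \<and> (\<forall>j. y $ j \<ge> l $ j)}"

text \<open>A sequence \<open>j\<^sub>1 \<rightarrow> \<dots> \<rightarrow> j\<^sub>\<tau>\<close> with \<open>\<tau> \<ge> 1\<close> is a nonempty list; repeated indices are allowed.\<close>

definition mixing_sequence ::
  "real ^ 'k ^ 'n \<Rightarrow> real ^ 'k \<Rightarrow> 'k \<Rightarrow> 'n list \<Rightarrow> bool" where
  "mixing_sequence W l j js \<longleftrightarrow>
     js \<noteq> [] \<and> sorted_wrt (\<lambda>a b. W $ a $ j \<ge> W $ b $ j) js \<and> W $ last js $ j \<ge> l $ j"

text \<open>
  Lists are indexed from 0, so \<open>seq_weight W l j js s\<close> is the weight at position \<open>s + 1\<close> of the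
  sequence, and the position just past the end carries the conventional weight \<open>l $ j\<close>.
\<close>

definition seq_weight ::
  "real ^ 'k ^ 'n \<Rightarrow> real ^ 'k \<Rightarrow> 'k \<Rightarrow> 'n list \<Rightarrow> nat \<Rightarrow> real" where
  "seq_weight W l j js s = (if s < length js then W $ (js ! s) $ j else l $ j)"

definition mixing_inequality ::
  "real ^ 'k ^ 'n \<Rightarrow> real ^ 'k \<Rightarrow> 'k \<Rightarrow> 'n list \<Rightarrow> real ^ 'k \<Rightarrow> real ^ 'n \<Rightarrow> bool" where
  "mixing_inequality W l j js y z \<longleftrightarrow>
     y $ j + (\<Sum>s<length js. (seq_weight W l j js s - seq_weight W l j js (Suc s)) * z $ (js ! s))
       \<ge> (MAX i. W $ i $ j)"

end

theory Submission imports Defs begin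

text \<open>
  Every mixing inequality holds on the mixed-binary set: along a sequence, the coefficients of the
  indices before the first one with \<open>z = 0\<close> telescope, and that index forces \<open>y\<close> to be at least
  its weight (if there is no such index, the telescoping sum ends at the lower bound of \<open>y\<close>).
  Since the described set is convex, it contains the convex hull.

  Conversely, let \<open>(y, z)\<close> satisfy all the inequalities and round \<open>z\<close> at a threshold \<open>t\<close> that is
  uniformly distributed in \<open>(0, 1]\<close>: put \<open>z\<^sub>i\<close> to 1 iff \<open>t \<le> z\<^sub>i\<close>. The rounded vector has
  expectation \<open>z\<close>, and the least admissible value of \<open>y\<^sub>j\<close> for it is the larger of \<open>l\<^sub>j\<close> and the
  weights of the indices rounded to 0 (\<open>level\<close>). The rounding of \<open>z\<close> does not depend on \<open>j\<close>,
  so the coordinates of \<open>y\<close> can be treated separately: it suffices that \<open>y\<^sub>j\<close> is at least the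
  expected level, because the difference can be added to \<open>y\<^sub>j\<close> in each rounded point. The lemma
  \<open>greedy_sequence\<close> exhibits a single mixing inequality for \<open>j\<close> that says this. Its sequence
  starts at an index of maximum weight and passes from \<open>a\<close> to a heaviest index among those with a
  smaller value of \<open>z\<close>. As \<open>z\<close> takes finitely many values, the uniform threshold can be replaced
  by finitely many weighted ones (\<open>threshold_weights\<close>), so that the expectation is a finite convex
  combination.
\<close>

section \<open>Mixing sums along a list\<close>

definition head_weight :: "real \<Rightarrow> ('n \<Rightarrow> real) \<Rightarrow> 'n list \<Rightarrow> real" where
  "head_weight l w js = (case js of [] \<Rightarrow> l | b # _ \<Rightarrow> w b)"

fun mixing_sum :: "real \<Rightarrow> ('n \<Rightarrow> real) \<Rightarrow> ('n \<Rightarrow> real) \<Rightarrow> 'n list \<Rightarrow> real" where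
  "mixing_sum l w z [] = 0"
| "mixing_sum l w z (a # js) = (w a - head_weight l w js) * z a + mixing_sum l w z js"

lemma seq_weight_0: "seq_weight W l j js 0 = head_weight (l $ j) (\<lambda>i. W $ i $ j) js"
  by (cases js) (auto simp: seq_weight_def head_weight_def)

lemma seq_weight_Cons_Suc: "seq_weight W l j (a # js) (Suc s) = seq_weight W l j js s"
  by (simp add: seq_weight_def)

lemma sum_eq_mixing_sum:
  "(\<Sum>s<length js. (seq_weight W l j js s - seq_weight W l j js (Suc s)) * z $ (js ! s))
     = mixing_sum (l $ j) (\<lambda>i. W $ i $ j) (\<lambda>i. z $ i) js"
proof (induction js)
  case (Cons a js)
  have "seq_weight W l j (a # js) 0 = W $ a $ j"
    by (simp add: seq_weight_def)
  with Cons show ?case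
    by (simp add: sum.lessThan_Suc_shift seq_weight_Cons_Suc seq_weight_0 del: sum.lessThan_Suc)
qed simp

lemma mixing_inequality_iff:
  "mixing_inequality W l j js y z \<longleftrightarrow>
     (MAX i. W $ i $ j) \<le> y $ j + mixing_sum (l $ j) (\<lambda>i. W $ i $ j) (\<lambda>i. z $ i) js"
  unfolding mixing_inequality_def sum_eq_mixing_sum by auto

text \<open>
  By monotonicity, the bound on the last weight is a bound on every weight; in this form the
  condition passes to the tail of a list.
\<close>

lemma mixing_sequence_iff:
  "mixing_sequence W l j js \<longleftrightarrow>
     js \<noteq> [] \<and> sorted_wrt (\<lambda>a b. W $ b $ j \<le> W $ a $ j) js \<and> (\<forall>i\<in>set js. l $ j \<le> W $ i $ j)"
proof (cases "js = []")
  case False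
  have "l $ j \<le> W $ i $ j"
    if "sorted_wrt (\<lambda>a b. W $ b $ j \<le> W $ a $ j) js" "l $ j \<le> W $ last js $ j" "i \<in> set js" for i
    using that False by (induction js) (auto split: if_splits intro: order_trans)
  with False show ?thesis
    by (auto simp: mixing_sequence_def)
qed (simp add: mixing_sequence_def)

lemma head_weight_le:
  "sorted_wrt (\<lambda>a b. w b \<le> w a) (a # js) \<Longrightarrow> l \<le> w a \<Longrightarrow> head_weight l w js \<le> w a"
  by (auto simp: head_weight_def split: list.split)

lemma mixing_sum_nonneg:
  assumes "sorted_wrt (\<lambda>a b. w b \<le> w a) js" "\<forall>i\<in>set js. l \<le> w i" "\<And>i. 0 \<le> z i"
  shows "0 \<le> mixing_sum l w z js"
  using assms
proof (induction js)
  case (Cons a js)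
  have "head_weight l w js \<le> w a"
    using Cons.prems by (intro head_weight_le) auto
  with Cons show ?case
    by simp
qed simp

text \<open>
  If the first index has \<open>z = 1\<close>, its term replaces the head weight of the tail by its own weight;
  if it has \<open>z = 0\<close>, then \<open>y\<close> alone is large enough and the other terms are nonnegative.
\<close>

lemma mixing_sum_valid:
  fixes y :: real
  assumes "sorted_wrt (\<lambda>a b. w b \<le> w a) js" "\<forall>i\<in>set js. l \<le> w i"
    and z: "\<And>i. z i \<in> {0, 1}" and y: "\<And>i. w i \<le> y + w i * z i" "l \<le> y"
  shows "head_weight l w js \<le> y + mixing_sum l w z js"
  using assms(1,2)
proof (induction js)
  case Nil
  then show ?case
    using y by (simp add: head_weight_def)
next
  case (Cons a js)
  have hd: "head_weight l w (a # js) = w a"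
    by (simp add: head_weight_def)
  show ?case
  proof (cases "z a = 0")
    case True
    have z_nonneg: "0 \<le> z i" for i
      using z[of i] by auto
    have "0 \<le> mixing_sum l w z js"
      using Cons.prems by (intro mixing_sum_nonneg z_nonneg) auto
    then show ?thesis
      using y(1)[of a] True hd by simp
  next
    case False
    then have "z a = 1"
      using z[of a] by simp
    then show ?thesis
      using Cons hd by simp
  qed
qed

lemma mixing_sum_affine:
  "mixing_sum l w (\<lambda>i. u * z i + v * z' i) js = u * mixing_sum l w z js + v * mixing_sum l w z' js"
  by (induction js) (simp_all add: algebra_simps)

section \<open>Rounding at thresholds\<close>

text \<open>
  The weight of a threshold is the gap to the preceding one, which is the length of the interval of
  thresholds in \<open>(0, \<infinity>)\<close> that have the same effect on the numbers in \<open>A\<close>.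
\<close>

lemma threshold_weights:
  fixes A :: "real set"
  assumes "finite A" "\<forall>a\<in>A. 0 \<le> a"
  obtains q where "\<And>t. 0 \<le> q t" "\<And>a. a \<in> A \<Longrightarrow> (\<Sum>t\<in>A. q t * of_bool (t \<le> a)) = a"
proof -
  have "\<exists>q. (\<forall>t. 0 \<le> q t) \<and> (\<forall>a\<in>A. (\<Sum>t\<in>A. q t * of_bool (t \<le> a)) = a)"
    using assms
  proof (induction A rule: finite_linorder_max_induct)
    case empty
    show ?case by (auto intro: exI[of _ "\<lambda>_. 0"])
  next
    case (insert b A)
    then obtain q where q: "\<And>t. 0 \<le> q t" "\<And>a. a \<in> A \<Longrightarrow> (\<Sum>t\<in>A. q t * of_bool (t \<le> a)) = a"
      by blast
    have notin: "b \<notin> A"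
      using insert.hyps by auto
    have total: "sum q A \<le> b"
    proof (cases "A = {}")
      case False
      have "sum q A = (\<Sum>t\<in>A. q t * of_bool (t \<le> Max A))"
        by (intro sum.cong) (use insert.hyps in auto)
      also have "\<dots> = Max A"
        using insert.hyps False by (intro q) auto
      also have "\<dots> \<le> b"
        using insert.hyps False by (simp add: less_imp_le)
      finally show ?thesis .
    qed (use insert.prems in simp)
    define q' where "q' = q(b := b - sum q A)"
    have q'_sum: "(\<Sum>t\<in>A. q' t * of_bool (t \<le> a)) = (\<Sum>t\<in>A. q t * of_bool (t \<le> a))" for a
      by (intro sum.cong) (use notin in \<open>auto simp: q'_def\<close>)
    have "(\<Sum>t\<in>insert b A. q' t * of_bool (t \<le> a)) = a" if "a \<in> insert b A" for a
    proof (cases "a = b")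
      case True
      have "(\<Sum>t\<in>A. q t * of_bool (t \<le> b)) = sum q A"
        by (intro sum.cong) (use insert.hyps in auto)
      then show ?thesis
        using True insert.hyps notin q'_sum by (simp add: q'_def)
    next
      case False
      then have "a \<in> A" "a < b"
        using that insert.hyps by auto
      moreover from this have "insert b A \<inter> {t. t \<le> a} = A \<inter> {t. t \<le> a}"
        by auto
      ultimately show ?thesis
        using insert.hyps q'_sum[of a] q(2)[of a] by simp
    qed
    moreover have "0 \<le> q' t" for t
      using q total by (simp add: q'_def)
    ultimately show ?case
      by blast
  qed
  then show ?thesis
    using that by blast
qed

text \<open>
  For \<open>l \<ge> 0\<close>, the least admissible value of \<open>y\<close> when exactly the indices with \<open>z i < t\<close> are
  rounded to 0: an index rounded to 1 only requires \<open>y \<ge> 0\<close>.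
\<close>

definition level :: "real \<Rightarrow> ('n \<Rightarrow> real) \<Rightarrow> ('n \<Rightarrow> real) \<Rightarrow> real \<Rightarrow> real" where
  "level l w z t = Max (insert l (w ` {i. z i < t}))"

lemma level_le_iff:
  fixes w :: "'n::finite \<Rightarrow> real"
  shows "level l w z t \<le> c \<longleftrightarrow> l \<le> c \<and> (\<forall>i. z i < t \<longrightarrow> w i \<le> c)"
  by (auto simp: level_def)

text \<open>
  The sequence moves from \<open>a\<close> to a heaviest index \<open>b\<close> with \<open>z b < z a\<close>, so that the last
  hypothesis on \<open>a\<close> holds for \<open>b\<close> too, and it stops when there is no such index or \<open>w b < l\<close>.
  For a threshold \<open>t \<le> z a\<close> the level is at most \<open>w b\<close>, so the positive part of \<open>w a - level\<close>
  exceeds that of \<open>w b - level\<close> by \<open>w a - w b\<close>. Such thresholds have total weight \<open>z a\<close>, and this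
  accounts for the term of \<open>a\<close> in the mixing sum; at the end of the sequence, \<open>l\<close> takes the place
  of \<open>w b\<close>. The positive parts are needed for the thresholds \<open>t > z a\<close>, where the level may be above
  \<open>w a\<close>: there the positive part still does not increase from \<open>a\<close> to \<open>b\<close>.
\<close>

lemma greedy_sequence:
  fixes w z q :: "_ \<Rightarrow> real" and a :: "'n::finite"
  assumes q: "\<And>t. 0 \<le> q t" "\<And>i. (\<Sum>t\<in>T. q t * of_bool (t \<le> z i)) = z i"
    and "l \<le> w a" "\<And>i. z i < z a \<Longrightarrow> w i \<le> w a"
  obtains js where "sorted_wrt (\<lambda>a b. w b \<le> w a) (a # js)" "\<forall>i\<in>set (a # js). l \<le> w i"
    "mixing_sum l w z (a # js) \<le> (\<Sum>t\<in>T. q t * max 0 (w a - level l w z t))"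
proof -
  have "\<exists>js. sorted_wrt (\<lambda>a b. w b \<le> w a) (a # js) \<and> (\<forall>i\<in>set (a # js). l \<le> w i) \<and>
          mixing_sum l w z (a # js) \<le> (\<Sum>t\<in>T. q t * max 0 (w a - level l w z t))"
    using assms(3,4)
  proof (induction "card {i. z i < z a}" arbitrary: a rule: less_induct)
    case less
    let ?S = "{i. z i < z a}"
    show ?case
    proof (cases "\<exists>i\<in>?S. l \<le> w i")
      case False
      have "(w a - l) * (\<Sum>t\<in>T. q t * of_bool (t \<le> z a)) =
          (\<Sum>t\<in>T. q t * ((w a - l) * of_bool (t \<le> z a)))"
        by (simp add: sum_distrib_left mult.left_commute)
      also have "\<dots> \<le> (\<Sum>t\<in>T. q t * max 0 (w a - level l w z t))"
      proof (intro sum_mono mult_left_mono q(1))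
        fix t
        have "level l w z t \<le> l" if "t \<le> z a"
          using False that unfolding level_le_iff
          by (metis le_cases less_le_trans mem_Collect_eq order_refl)
        then show "(w a - l) * of_bool (t \<le> z a) \<le> max 0 (w a - level l w z t)"
          by auto
      qed
      finally show ?thesis
        using less.prems by (intro exI[of _ "[]"]) (simp add: head_weight_def q(2))
    next
      case True
      then have ne: "w ` ?S \<noteq> {}"
        by auto
      then obtain b where b: "b \<in> ?S" "w b = Max (w ` ?S)"
        using Max_in[OF finite_imageI[OF finite] ne] by (elim imageE) simp
      have b_max: "w i \<le> w b" if "z i < z a" for i
        unfolding b(2) using that by (intro Max_ge) auto
      have "l \<le> w b"
        using True b_max by fastforce
      have "w b \<le> w a"
        using b(1) less.prems by simp
      have "{i. z i < z b} \<subset> ?S"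
        using b by auto
      then have "card {i. z i < z b} < card ?S"
        by (intro psubset_card_mono) auto
      moreover have "w i \<le> w b" if "z i < z b" for i
        using b that by (intro b_max) auto
      ultimately obtain js where js: "sorted_wrt (\<lambda>a b. w b \<le> w a) (b # js)"
          "\<forall>i\<in>set (b # js). l \<le> w i"
          "mixing_sum l w z (b # js) \<le> (\<Sum>t\<in>T. q t * max 0 (w b - level l w z t))"
        using less.hyps[of b] \<open>l \<le> w b\<close> by blast
      have "mixing_sum l w z (a # b # js)
          = (w a - w b) * (\<Sum>t\<in>T. q t * of_bool (t \<le> z a)) + mixing_sum l w z (b # js)"
        by (simp add: head_weight_def q(2))
      also have "(w a - w b) * (\<Sum>t\<in>T. q t * of_bool (t \<le> z a)) =
          (\<Sum>t\<in>T. q t * ((w a - w b) * of_bool (t \<le> z a)))"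
        by (simp add: sum_distrib_left mult.left_commute)
      also have "\<dots> + mixing_sum l w z (b # js) \<le>
          (\<Sum>t\<in>T. q t * ((w a - w b) * of_bool (t \<le> z a) + max 0 (w b - level l w z t)))"
        using js(3) by (simp add: distrib_left sum.distrib)
      also have "\<dots> \<le> (\<Sum>t\<in>T. q t * max 0 (w a - level l w z t))"
      proof (intro sum_mono mult_left_mono q(1))
        fix t
        have "level l w z t \<le> w b" if "t \<le> z a"
          using \<open>l \<le> w b\<close> that b_max unfolding level_le_iff by fastforce
        then show "(w a - w b) * of_bool (t \<le> z a) + max 0 (w b - level l w z t)
            \<le> max 0 (w a - level l w z t)"
          using \<open>w b \<le> w a\<close> by auto
      qed
      finally have "mixing_sum l w z (a # b # js) \<le> (\<Sum>t\<in>T. q t * max 0 (w a - level l w z t))" .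
      moreover have "sorted_wrt (\<lambda>a b. w b \<le> w a) (a # b # js)"
        using js(1) \<open>w b \<le> w a\<close> by (auto intro: order_trans)
      ultimately show ?thesis
        using js(2) less.prems by (intro exI[of _ "b # js"]) auto
    qed
  qed
  then show ?thesis
    using that by blast
qed

section \<open>The convex hull\<close>

definition mixing_polyhedron ::
  "real ^ 'k ^ 'n \<Rightarrow> real ^ 'k \<Rightarrow> ((real ^ 'k) \<times> (real ^ 'n)) set" where
  "mixing_polyhedron W l =
     {(y, z). (\<forall>i. 0 \<le> z $ i \<and> z $ i \<le> 1)
       \<and> (\<forall>j js. mixing_sequence W l j js \<and> W $ hd js $ j = (MAX i. W $ i $ j)
             \<longrightarrow> mixing_inequality W l j js y z)}"

lemma mixing_set0_subset_mixing_polyhedron: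
  "mixing_set0 W l \<subseteq> mixing_polyhedron W l"
proof clarify
  fix y z assume "(y, z) \<in> mixing_set0 W l"
  then have z: "\<And>i. z $ i \<in> {0, 1}" and y: "\<And>i j. W $ i $ j \<le> y $ j + W $ i $ j * z $ i"
      "\<And>j. l $ j \<le> y $ j"
    by (auto simp: mixing_set0_def)
  have "mixing_inequality W l j js y z"
    if "mixing_sequence W l j js" "W $ hd js $ j = (MAX i. W $ i $ j)" for j js
  proof -
    have "head_weight (l $ j) (\<lambda>i. W $ i $ j) js
        \<le> y $ j + mixing_sum (l $ j) (\<lambda>i. W $ i $ j) (\<lambda>i. z $ i) js"
      using that(1) by (intro mixing_sum_valid z y) (auto simp: mixing_sequence_iff)
    moreover have "head_weight (l $ j) (\<lambda>i. W $ i $ j) js = W $ hd js $ j"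
      using that(1) by (cases js) (auto simp: mixing_sequence_iff head_weight_def)
    ultimately show ?thesis
      using that(2) by (simp add: mixing_inequality_iff)
  qed
  moreover have "0 \<le> z $ i \<and> z $ i \<le> 1" for i
    using z[of i] by auto
  ultimately show "(y, z) \<in> mixing_polyhedron W l"
    by (auto simp: mixing_polyhedron_def)
qed

lemma convex_mixing_polyhedron: "convex (mixing_polyhedron W l)"
proof (rule convexI, clarify)
  fix y z y' z' and u v :: real
  assume yz: "(y, z) \<in> mixing_polyhedron W l" and yz': "(y', z') \<in> mixing_polyhedron W l"
    and uv: "0 \<le> u" "0 \<le> v" "u + v = 1"
  have "0 \<le> (u *\<^sub>R z + v *\<^sub>R z') $ i \<and> (u *\<^sub>R z + v *\<^sub>R z') $ i \<le> 1" for i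
    using yz yz' uv by (auto simp: mixing_polyhedron_def intro: convex_bound_le)
  moreover have "mixing_inequality W l j js (u *\<^sub>R y + v *\<^sub>R y') (u *\<^sub>R z + v *\<^sub>R z')"
    if "mixing_sequence W l j js" "W $ hd js $ j = (MAX i. W $ i $ j)" for j js
  proof -
    let ?M = "MAX i. W $ i $ j" and ?m = "\<lambda>z. mixing_sum (l $ j) (\<lambda>i. W $ i $ j) (\<lambda>i. z $ i) js"
    have "?M \<le> y $ j + ?m z" "?M \<le> y' $ j + ?m z'"
      using yz yz' that by (auto simp: mixing_polyhedron_def mixing_inequality_iff)
    then have "u * ?M + v * ?M \<le> u * (y $ j + ?m z) + v * (y' $ j + ?m z')"
      using uv by (intro add_mono mult_left_mono)
    moreover have "u * ?M + v * ?M = ?M"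
      using uv by (metis distrib_right mult_1)
    ultimately show ?thesis
      by (simp add: mixing_inequality_iff mixing_sum_affine distrib_left add.assoc add.left_commute)
  qed
  ultimately show "u *\<^sub>R (y, z) + v *\<^sub>R (y', z') \<in> mixing_polyhedron W l"
    by (simp add: mixing_polyhedron_def)
qed

lemma mixing_polyhedron_subset_hull:
  fixes W :: "real ^ 'k ^ 'n" and l :: "real ^ 'k"
  assumes l_nonneg: "\<And>j. l $ j \<ge> 0"
    and l_le_max: "\<And>j. l $ j \<le> (MAX i. W $ i $ j)"
  shows "mixing_polyhedron W l \<subseteq> convex hull (mixing_set0 W l)"
proof clarify
  fix y z assume yz: "(y, z) \<in> mixing_polyhedron W l"
  then have z: "0 \<le> z $ i" "z $ i \<le> 1" for i
    by (auto simp: mixing_polyhedron_def)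
  \<comment> \<open>The threshold 1 makes the weights add up to 1.\<close>
  define T where "T = insert 1 (range (\<lambda>i. z $ i))"
  have "finite T"
    by (simp add: T_def)
  moreover have "\<forall>a\<in>T. 0 \<le> a"
    using z by (auto simp: T_def)
  ultimately obtain q where q: "\<And>t. 0 \<le> q t" "\<And>a. a \<in> T \<Longrightarrow> (\<Sum>t\<in>T. q t * of_bool (t \<le> a)) = a"
    using threshold_weights[of T] by blast
  have q_z: "(\<Sum>t\<in>T. q t * of_bool (t \<le> z $ i)) = z $ i" for i
    by (intro q) (simp add: T_def)
  have q_total: "sum q T = 1"
  proof -
    have "sum q T = (\<Sum>t\<in>T. q t * of_bool (t \<le> 1))"
      by (intro sum.cong) (use z in \<open>auto simp: T_def\<close>)
    also have "\<dots> = 1"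
      by (intro q) (simp add: T_def)
    finally show ?thesis .
  qed
  define v where "v j t = level (l $ j) (\<lambda>i. W $ i $ j) (\<lambda>i. z $ i) t" for j t
  define d where "d j = y $ j - (\<Sum>t\<in>T. q t * v j t)" for j
  have d_nonneg: "0 \<le> d j" for j
  proof -
    let ?M = "MAX i. W $ i $ j"
    have le_M: "W $ i $ j \<le> ?M" for i
      by (rule Max_ge) auto
    obtain a where a: "W $ a $ j = ?M"
    proof -
      have "?M \<in> range (\<lambda>i. W $ i $ j)"
        by (intro Max_in) auto
      then show ?thesis
        using that by (elim imageE) simp
    qed
    obtain js where js: "sorted_wrt (\<lambda>a b. W $ b $ j \<le> W $ a $ j) (a # js)"
        "\<forall>i\<in>set (a # js). l $ j \<le> W $ i $ j"
        "mixing_sum (l $ j) (\<lambda>i. W $ i $ j) (\<lambda>i. z $ i) (a # js)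
          \<le> (\<Sum>t\<in>T. q t * max 0 (W $ a $ j - v j t))"
      unfolding v_def
      by (rule greedy_sequence[of q "\<lambda>i. z $ i" T "l $ j" "\<lambda>i. W $ i $ j" a])
        (use q(1) q_z a l_le_max le_M in auto)
    have "v j t \<le> ?M" for t
      unfolding v_def level_le_iff using l_le_max le_M by auto
    then have "max 0 (W $ a $ j - v j t) = ?M - v j t" for t
      by (simp add: a)
    then have "(\<Sum>t\<in>T. q t * max 0 (W $ a $ j - v j t)) = ?M - (\<Sum>t\<in>T. q t * v j t)"
      by (simp add: right_diff_distrib sum_subtractf q_total flip: sum_distrib_right)
    moreover have "mixing_inequality W l j (a # js) y z"
      using yz js(1,2) a by (simp add: mixing_polyhedron_def mixing_sequence_iff)
    ultimately show ?thesis
      using js(3) unfolding d_def mixing_inequality_iff by linarith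
  qed
  define p where "p t = ((\<chi> j. v j t + d j), (\<chi> i. of_bool (t \<le> z $ i)) :: real ^ 'n)" for t
  have "p t \<in> mixing_set0 W l" for t
  proof -
    have v: "l $ j \<le> v j t" "z $ i < t \<Longrightarrow> W $ i $ j \<le> v j t" for i j
      using level_le_iff[of "l $ j" "\<lambda>i. W $ i $ j" "\<lambda>i. z $ i" t "v j t"] by (auto simp: v_def)
    have "W $ i $ j \<le> v j t + d j + W $ i $ j * of_bool (t \<le> z $ i)" for i j
      using v(1)[of j] v(2)[of i j] l_nonneg[of j] d_nonneg[of j] by (cases "t \<le> z $ i") auto
    moreover have "l $ j \<le> v j t + d j" for j
      using v(1)[of j] d_nonneg[of j] by simp
    ultimately show ?thesis
      by (simp add: mixing_set0_def p_def)
  qed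
  then have "(\<Sum>t\<in>T. q t *\<^sub>R p t) \<in> convex hull (mixing_set0 W l)"
    by (intro convex_sum \<open>finite T\<close> convex_convex_hull q_total q(1) hull_inc)
  also have "(\<Sum>t\<in>T. q t *\<^sub>R p t) = (y, z)"
  proof (rule prod_eqI)
    have "(\<Sum>t\<in>T. q t * (v j t + d j)) = y $ j" for j
      by (simp add: distrib_left sum.distrib q_total d_def flip: sum_distrib_right)
    then show "fst (\<Sum>t\<in>T. q t *\<^sub>R p t) = fst (y, z)"
      by (simp add: fst_sum p_def vec_eq_iff)
    show "snd (\<Sum>t\<in>T. q t *\<^sub>R p t) = snd (y, z)"
      using q_z by (simp add: snd_sum p_def vec_eq_iff)
  qed
  finally show "(y, z) \<in> convex hull (mixing_set0 W l)" .
qed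

theorem theorem3p1:
  fixes W :: "real ^ 'k ^ 'n" and l :: "real ^ 'k"
  assumes W_nonneg: "\<And>i j. W $ i $ j \<ge> 0"
    and l_nonneg: "\<And>j. l $ j \<ge> 0"
    and l_le_max: "\<And>j. l $ j \<le> (MAX i. W $ i $ j)"
  shows "convex hull (mixing_set0 W l) =
    {(y, z). (\<forall>i. 0 \<le> z $ i \<and> z $ i \<le> 1)
       \<and> (\<forall>j js. mixing_sequence W l j js \<and> W $ hd js $ j = (MAX i. W $ i $ j)
             \<longrightarrow> mixing_inequality W l j js y z)}"
proof -
  have "convex hull (mixing_set0 W l) \<subseteq> mixing_polyhedron W l"
    by (intro hull_minimal mixing_set0_subset_mixing_polyhedron convex_mixing_polyhedron)
  moreover have "mixing_polyhedron W l \<subseteq> convex hull (mixing_set0 W l)"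
    by (intro mixing_polyhedron_subset_hull l_nonneg l_le_max)
  ultimately show ?thesis
    unfolding mixing_polyhedron_def by (rule subset_antisym)
qed

end
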